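(* Let $\Lambda\in[\frac12,1]$, $a\equiv0$, $\frac38<b_0<\frac12$, and let $I\subseteq\mathbb{R}$ be a bounded interval with nonempty interior. There exists no constant $C>0$, independent of $h$, such that $$\|P_hU\|_{L^4(I\times\mathbb{T})}\le C\|P_hU\|_{X_h^{0,b_0}(I)}$$ holds for all sufficiently small admissible $h$ and all spacetime functions $U:I\times\mathbb{T}\to\mathbb{C}$.
   Context: Notation: $\mathbb{T}=\mathbb{R}/(2\pi\mathbb{Z})$. A mesh size $h$ is admissible if $h=\pi/M$ with $M\in\mathbb{N}$; $\mathbb{T}_h^*=\{-M,\dots,M-1\}$ and $E_h=\{k\in\mathbb{T}_h^*:|hk|\le\Lambda\pi\}$. For $f$ on $\mathbb{T}$, $\widehat f(k)=\frac1{2\pi}\int_{\mathbb{T}}f(x)e^{-ikx}dx$; $P_h$ is the spatial Fourier projector $\widehat{P_hf}(k)=\mathbf{1}_{E_h}(k)\widehat f(k)$. With $a\equiv0$ the phases are $\phi_{h,k}(t)=t\,\omega_{h,0}(k)$, $\omega_{h,0}(k)=\frac4{h^2}\sin^2\left(\frac{hk}2\right)$. Time-restricted norm: $\|f\|_{H^b(I)}=\inf\{\|F\|_{H^b(\mathbb{R})}:F|_I=f\}$. For functions with spatial frequencies in $\mathbb{T}_h^*$, $\|U\|_{X_h^{0,b}(I)}^2=\sum_{k\in\mathbb{T}_h^*}\|e^{i\phi_{h,k}(t)}\widehat U(k,t)\|_{H_t^b(I)}^2$. *)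

theory Defs
  imports "HOL-Analysis.Analysis"
begin

section \<open>Lebesgue norms\<close>

definition ennreal_root :: "nat \<Rightarrow> ennreal \<Rightarrow> ennreal" where
  "ennreal_root n x = (if x = \<infinity> then \<infinity> else ennreal (root n (enn2real x)))"

definition Lp_norm :: "nat \<Rightarrow> 'a::euclidean_space set \<Rightarrow> ('a \<Rightarrow> complex) \<Rightarrow> ennreal" where
  "Lp_norm p A f = ennreal_root p (\<integral>\<^sup>+x\<in>A. ennreal (cmod (f x) ^ p) \<partial>lborel)"

definition square_integrable :: "(real \<Rightarrow> complex) \<Rightarrow> bool" where
  "square_integrable f \<longleftrightarrow> f \<in> borel_measurable lborel \<and> Lp_norm 2 UNIV f < \<infinity>"


section \<open>The Sobolev spaces \<open>H\<^sup>b\<close> in time\<close>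

text \<open>
  For a square integrable \<open>F\<close> the Fourier transform is the limit in mean of the
  truncated Fourier integrals. It exists by Plancherel and is unique up to null sets;
  \<open>L2_fourier\<close> picks a representative.
\<close>

definition is_L2_fourier :: "(real \<Rightarrow> complex) \<Rightarrow> (real \<Rightarrow> complex) \<Rightarrow> bool" where
  "is_L2_fourier F G \<longleftrightarrow> square_integrable G \<and>
     ((\<lambda>R::real. Lp_norm 2 UNIV
         (\<lambda>\<tau>. G \<tau> - (CLINT t:{-R..R}|lborel. F t * cis (- (t * \<tau>))))) \<longlongrightarrow> 0) at_top"

definition L2_fourier :: "(real \<Rightarrow> complex) \<Rightarrow> real \<Rightarrow> complex" where
  "L2_fourier F = (SOME G. is_L2_fourier F G)"

text \<open>
  Only meant for \<open>b \<ge> 0\<close>, where \<open>H\<^sup>b\<close> is contained in \<open>L\<^sup>2\<close>. The value is \<open>\<infinity>\<close> for functions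
  outside \<open>H\<^sup>b\<close>.
\<close>

definition Hb_norm :: "real \<Rightarrow> (real \<Rightarrow> complex) \<Rightarrow> ennreal" where
  "Hb_norm b F =
     (if square_integrable F
      then ennreal_root 2
             (\<integral>\<^sup>+\<tau>. ennreal ((1 + \<tau>\<^sup>2) powr b * (cmod (L2_fourier F \<tau>))\<^sup>2) \<partial>lborel)
      else \<infinity>)"

definition Hb_norm_on :: "real \<Rightarrow> real set \<Rightarrow> (real \<Rightarrow> complex) \<Rightarrow> ennreal" where
  "Hb_norm_on b I f = (INF F \<in> {F. AE t in lborel. t \<in> I \<longrightarrow> F t = f t}. Hb_norm b F)"


section \<open>Functions on the torus and on the spacetime domain\<close>

text \<open>
  Functions on \<open>\<real>/(2\<pi>\<int>)\<close> are \<open>2\<pi>\<close>-periodic functions on \<open>\<real>\<close>, and integrals over the torus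
  are integrals over the fundamental domain \<open>[-\<pi>, \<pi>]\<close>.
\<close>

definition fourier_coeff :: "(real \<Rightarrow> complex) \<Rightarrow> int \<Rightarrow> complex" where
  "fourier_coeff f k =
     complex_of_real (1 / (2 * pi)) * (CLINT x:{-pi..pi}|lborel. f x * cis (- (of_int k * x)))"

text \<open>
  The spacetime functions \<open>I \<times> \<T> \<rightarrow> \<complex>\<close> for which the spatial Fourier coefficients make sense
  at almost every time. Values at times outside \<open>I\<close> are irrelevant.
\<close>

definition spacetime_function :: "real set \<Rightarrow> (real \<Rightarrow> real \<Rightarrow> complex) \<Rightarrow> bool" where
  "spacetime_function I U \<longleftrightarrow>
     (\<forall>t\<in>I. \<forall>x. U t (x + 2 * pi) = U t x) \<and>
     set_borel_measurable lborel (I \<times> {-pi..pi}) (\<lambda>(t, x). U t x) \<and>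
     (AE t in lborel. t \<in> I \<longrightarrow> set_integrable lborel {-pi..pi} (U t))"


section \<open>Mesh, projector and Bourgain norm\<close>

definition admissible :: "real \<Rightarrow> bool" where
  "admissible h \<longleftrightarrow> (\<exists>M::nat. M > 0 \<and> h = pi / real M)"

definition mesh_freqs :: "real \<Rightarrow> int set" where
  "mesh_freqs h = {k. \<exists>M::nat. M > 0 \<and> h = pi / real M \<and> k \<in> {- int M..<int M}}"

definition E_freqs :: "real \<Rightarrow> real \<Rightarrow> int set" where
  "E_freqs \<Lambda> h = {k \<in> mesh_freqs h. \<bar>h * of_int k\<bar> \<le> \<Lambda> * pi}"

text \<open>
  The projector is given by its (finite) Fourier series; the lemma \<open>fourier_coeff_proj\<close>
  below shows that it is the Fourier multiplier with symbol the indicator of \<open>E_freqs \<Lambda> h\<close>.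
\<close>

definition proj :: "real \<Rightarrow> real \<Rightarrow> (real \<Rightarrow> complex) \<Rightarrow> real \<Rightarrow> complex" where
  "proj \<Lambda> h f x = (\<Sum>k\<in>E_freqs \<Lambda> h. fourier_coeff f k * cis (of_int k * x))"

definition spacetime_proj ::
    "real \<Rightarrow> real \<Rightarrow> (real \<Rightarrow> real \<Rightarrow> complex) \<Rightarrow> real \<Rightarrow> real \<Rightarrow> complex" where
  "spacetime_proj \<Lambda> h U t = proj \<Lambda> h (U t)"

definition omega0 :: "real \<Rightarrow> int \<Rightarrow> real" where
  "omega0 h k = 4 / h\<^sup>2 * (sin (h * of_int k / 2))\<^sup>2"

text \<open>The phases for vanishing \<open>a\<close>.\<close>

definition phase0 :: "real \<Rightarrow> int \<Rightarrow> real \<Rightarrow> real" where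
  "phase0 h k t = t * omega0 h k"

definition X0_norm_on :: "real \<Rightarrow> real \<Rightarrow> real set \<Rightarrow> (real \<Rightarrow> real \<Rightarrow> complex) \<Rightarrow> ennreal" where
  "X0_norm_on h b I U =
     ennreal_root 2 (\<Sum>k\<in>mesh_freqs h.
       (Hb_norm_on b I (\<lambda>t. cis (phase0 h k t) * fourier_coeff (U t) k))\<^sup>2)"


section \<open>The projector is a Fourier multiplier\<close>

lemma mesh_freqs_pi: "M > 0 \<Longrightarrow> mesh_freqs (pi / real M) = {- int M..<int M}"
  unfolding mesh_freqs_def by auto

lemma finite_mesh_freqs: "finite (mesh_freqs h)"
proof (cases "admissible h")
  case True
  then show ?thesis unfolding admissible_def by (auto simp: mesh_freqs_pi)
next
  case False
  then have "mesh_freqs h = {}" unfolding admissible_def mesh_freqs_def by blast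
  then show ?thesis by simp
qed

lemma finite_E_freqs: "finite (E_freqs \<Lambda> h)"
  using finite_mesh_freqs[of h] unfolding E_freqs_def by auto

lemma set_integrable_cis:
  "set_integrable lborel {-pi..pi} (\<lambda>x. c * cis (of_int n * x))"
  by (intro borel_integrable_atLeastAtMost' continuous_intros)

lemma integral_cis:
  "(CLINT x:{-pi..pi}|lborel. cis (of_int n * x)) = (if n = 0 then of_real (2 * pi) else 0)"
proof (cases "n = 0")
  case True
  then show ?thesis
    by (simp add: set_integral_const[of "{-pi..pi}"] scaleR_conv_of_real)
next
  case False
  define F where "F = (\<lambda>x. cis (of_int n * x) / (\<i> * of_int n))"
  have "(CLINT x:{-pi..pi}|lborel. cis (of_int n * x)) = F pi - F (- pi)"
    unfolding set_lebesgue_integral_def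
  proof (rule integral_FTC_Icc)
    fix x
    have "((\<lambda>z. exp (\<i> * of_int n * z) / (\<i> * of_int n)) has_field_derivative
        exp (\<i> * of_int n * of_real x)) (at (of_real x))"
      using False by (auto intro!: derivative_eq_intros)
    from has_vector_derivative_real_field[OF this]
    show "(F has_vector_derivative cis (of_int n * x)) (at x within {-pi..pi})"
      unfolding F_def cis_conv_exp by (simp add: mult.assoc)
  qed (auto intro!: continuous_intros)
  also have "cis (of_int n * pi) = cis (of_int n * (- pi))"
    using sin_zero_iff_int2[of "of_int n * pi"] by (auto simp: complex_eq_iff)
  then have "F pi - F (- pi) = 0" unfolding F_def by simp
  finally show ?thesis using False by simp
qed

lemma fourier_coeff_proj:
  "fourier_coeff (proj \<Lambda> h f) k = (if k \<in> E_freqs \<Lambda> h then fourier_coeff f k else 0)"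
proof -
  have "(CLINT x:{-pi..pi}|lborel. proj \<Lambda> h f x * cis (- (of_int k * x)))
      = (CLINT x:{-pi..pi}|lborel.
           (\<Sum>j\<in>E_freqs \<Lambda> h. fourier_coeff f j * cis (of_int (j - k) * x)))"
    by (simp add: proj_def sum_distrib_right mult.assoc cis_mult left_diff_distrib)
  also have "\<dots> = (\<Sum>j\<in>E_freqs \<Lambda> h.
      (CLINT x:{-pi..pi}|lborel. fourier_coeff f j * cis (of_int (j - k) * x)))"
    unfolding set_lebesgue_integral_def scaleR_sum_right
    by (rule Bochner_Integration.integral_sum)
      (rule set_integrable_cis[unfolded set_integrable_def])
  also have "\<dots> = (\<Sum>j\<in>E_freqs \<Lambda> h.
      (if j = k then fourier_coeff f k * of_real (2 * pi) else 0))"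
    by (intro sum.cong refl) (auto simp: integral_cis simp del: of_int_diff)
  also have "\<dots> = (if k \<in> E_freqs \<Lambda> h then fourier_coeff f k * of_real (2 * pi) else 0)"
    using finite_E_freqs by simp
  finally show ?thesis unfolding fourier_coeff_def[of "proj \<Lambda> h f"] by simp
qed

end

theory Submission
  imports Defs "HOL-Real_Asymp.Real_Asymp"
begin

text \<open>
  The dispersion relation has an inflection point at \<open>h k = \<pi> / 2\<close>, which the projector keeps
  because \<open>\<Lambda> \<ge> 1 / 2\<close>. Near it the relation is affine up to a cubic remainder of size \<open>h\<close>, so for
  fixed \<open>N\<close> and small \<open>h\<close> the free solution with \<open>N\<close> adjacent frequencies just below the inflection
  point does not disperse on \<open>I\<close>: it stays close to a Dirichlet kernel travelling with group
  velocity \<open>2 / h\<close>, and its \<open>L\<^sup>4\<close> norm is at least a constant times \<open>N\<^bsup>3/4\<^esup>\<close>. After removal of the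
  phases its Fourier coefficients are the constant \<open>1\<close>, which extends from \<open>I\<close> to the indicator
  function of a compact interval; that function lies in \<open>H\<^sup>b\<close> since \<open>b < 1 / 2\<close>. Hence the Bourgain
  norm is at most a constant times \<open>N\<^bsup>1/2\<^esup>\<close>, and letting \<open>N\<close> grow rules out any \<open>C\<close>.
\<close>

section \<open>Roots of extended nonnegative reals\<close>

lemma ennreal_root_mono: "x \<le> y \<Longrightarrow> n > 0 \<Longrightarrow> ennreal_root n x \<le> ennreal_root n y"
  unfolding ennreal_root_def
  by (auto simp: top.extremum_unique less_top intro!: ennreal_leI real_root_le_mono enn2real_mono)

lemma ennreal_root_ennreal: "x \<ge> 0 \<Longrightarrow> ennreal_root n (ennreal x) = ennreal (root n x)"
  unfolding ennreal_root_def by simp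

lemma ennreal_root_eq_0_iff: "n > 0 \<Longrightarrow> ennreal_root n x = 0 \<longleftrightarrow> x = 0"
  unfolding ennreal_root_def
  by (cases x) (auto simp: ennreal_eq_0_iff)

lemma ennreal_root_less_top_iff: "ennreal_root n x < \<infinity> \<longleftrightarrow> x < \<infinity>"
  unfolding ennreal_root_def by (auto simp: less_top)

section \<open>Sobolev norms from explicit Fourier transforms\<close>

text \<open>\<open>L2_fourier\<close> is a choice, fixed only up to null sets. When the truncated
  Fourier integrals are eventually \<open>G\<close>, the distance of any candidate limit to them is
  eventually its distance to \<open>G\<close>; a constant tending to 0 is 0, so the chosen limit
  agrees with \<open>G\<close> almost everywhere.\<close>

lemma L2_fourier_AE_eq:
  assumes G: "square_integrable G"
    and ev: "\<forall>\<^sub>F R in at_top. \<forall>\<tau>. (CLINT t:{-R..R}|lborel. F t * cis (- (t * \<tau>))) = G \<tau>"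
  shows "AE \<tau> in lborel. L2_fourier F \<tau> = G \<tau>"
proof -
  define T where "T = (\<lambda>R \<tau>. CLINT t:{-R..R}|lborel. F t * cis (- (t * \<tau>)))"
  \<comment> \<open>The general \<open>K\<close> serves twice: \<open>G\<close> gives existence of a
    limit in mean, \<open>L2_fourier F\<close> gives uniqueness.\<close>
  have ev': "\<forall>\<^sub>F R in at_top. Lp_norm 2 UNIV (\<lambda>\<tau>. K \<tau> - T R \<tau>) = Lp_norm 2 UNIV (\<lambda>\<tau>. K \<tau> - G \<tau>)" for K
    using ev by eventually_elim (simp add: T_def)
  have "Lp_norm 2 UNIV (\<lambda>\<tau>. G \<tau> - G \<tau>) = 0"
    by (simp add: Lp_norm_def ennreal_root_def)
  then have "((\<lambda>R. Lp_norm 2 UNIV (\<lambda>\<tau>. G \<tau> - T R \<tau>)) \<longlongrightarrow> 0) at_top"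
    using ev'[of G] by (intro tendsto_eventually) simp
  with G have "is_L2_fourier F G"
    unfolding is_L2_fourier_def T_def by simp
  then have L: "is_L2_fourier F (L2_fourier F)"
    unfolding L2_fourier_def by (rule someI[of "is_L2_fourier F"])
  have "((\<lambda>R. Lp_norm 2 UNIV (\<lambda>\<tau>. L2_fourier F \<tau> - T R \<tau>)) \<longlongrightarrow> 0) at_top"
    using L unfolding is_L2_fourier_def T_def by simp
  then have "((\<lambda>R::real. Lp_norm 2 UNIV (\<lambda>\<tau>. L2_fourier F \<tau> - G \<tau>)) \<longlongrightarrow> 0) at_top"
    using tendsto_cong[OF ev'[of "L2_fourier F"]] by simp
  then have "Lp_norm 2 UNIV (\<lambda>\<tau>. L2_fourier F \<tau> - G \<tau>) = 0"
    by (simp add: tendsto_const_iff)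
  then have *: "(\<integral>\<^sup>+\<tau>. ennreal ((cmod (L2_fourier F \<tau> - G \<tau>))\<^sup>2) \<partial>lborel) = 0"
    unfolding Lp_norm_def by (simp add: ennreal_root_eq_0_iff)
  have [measurable]: "L2_fourier F \<in> borel_measurable borel" "G \<in> borel_measurable borel"
    using L G unfolding is_L2_fourier_def square_integrable_def by auto
  from * have "AE \<tau> in lborel. ennreal ((cmod (L2_fourier F \<tau> - G \<tau>))\<^sup>2) = 0"
    by (subst (asm) nn_integral_0_iff_AE) auto
  then show ?thesis by eventually_elim (simp add: ennreal_eq_0_iff)
qed

lemma Hb_norm_eq:
  assumes "square_integrable F" and "square_integrable G"
    and "\<forall>\<^sub>F R in at_top. \<forall>\<tau>. (CLINT t:{-R..R}|lborel. F t * cis (- (t * \<tau>))) = G \<tau>"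
  shows "Hb_norm b F =
    ennreal_root 2 (\<integral>\<^sup>+\<tau>. ennreal ((1 + \<tau>\<^sup>2) powr b * (cmod (G \<tau>))\<^sup>2) \<partial>lborel)"
proof -
  have "(\<integral>\<^sup>+\<tau>. ennreal ((1 + \<tau>\<^sup>2) powr b * (cmod (L2_fourier F \<tau>))\<^sup>2) \<partial>lborel)
      = (\<integral>\<^sup>+\<tau>. ennreal ((1 + \<tau>\<^sup>2) powr b * (cmod (G \<tau>))\<^sup>2) \<partial>lborel)"
    using L2_fourier_AE_eq[OF assms(2,3)] by (intro nn_integral_cong_AE) auto
  with assms(1) show ?thesis unfolding Hb_norm_def by simp
qed

text \<open>Frequencies outside the packet thus contribute nothing to the Bourgain norm.\<close>

lemma Hb_norm_on_zero: "Hb_norm_on b I (\<lambda>_. 0) = 0"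
proof -
  have "square_integrable (\<lambda>_. 0)"
    by (simp add: square_integrable_def Lp_norm_def ennreal_root_def)
  then have "Hb_norm b (\<lambda>_. 0) = 0"
    by (subst Hb_norm_eq[where G = "\<lambda>_. 0"]) (auto simp: ennreal_root_def)
  moreover have "Hb_norm_on b I (\<lambda>_. 0) \<le> Hb_norm b (\<lambda>_. 0)"
    unfolding Hb_norm_on_def by (rule INF_lower) auto
  ultimately show ?thesis by simp
qed

section \<open>Indicators of compact intervals lie in the Sobolev space for exponents below
  1/2\<close>

lemma nn_integral_powr_atLeast_1:
  assumes "e < -1"
  shows "(\<integral>\<^sup>+x. ennreal (x powr e) * indicator {1..} x \<partial>lborel) < \<infinity>"
proof -
  have "((\<lambda>x::real. x powr (e + 1) / (e + 1)) \<longlongrightarrow> 0 / (e + 1)) at_top"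
    using assms by (intro tendsto_divide tendsto_neg_powr tendsto_const filterlim_ident) auto
  then have "(\<integral>\<^sup>+x. ennreal (x powr e) * indicator {1..} x \<partial>lborel)
      = ennreal (0 - 1 powr (e + 1) / (e + 1))"
    using assms
    by (intro nn_integral_FTC_atLeast) (auto intro!: derivative_eq_intros)
  then show ?thesis by simp
qed

text \<open>Bounded by \<open>A\<close> near the origin and by \<open>B / \<bar>\<tau>\<bar>\<close>
  away from it, \<open>g\<close> makes the weighted integrand of order
  \<open>\<bar>\<tau>\<bar> powr (2 * b - 2)\<close> at infinity, which is integrable because
  \<open>b < 1 / 2\<close>.\<close>

lemma nn_integral_Sobolev_weight_bounded:
  fixes g :: "real \<Rightarrow> complex"
  assumes b: "0 \<le> b" "b < 1 / 2"
    and A: "\<And>\<tau>. cmod (g \<tau>) \<le> A" and B: "\<And>\<tau>. cmod (g \<tau>) * \<bar>\<tau>\<bar> \<le> B"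
  shows "(\<integral>\<^sup>+\<tau>. ennreal ((1 + \<tau>\<^sup>2) powr b * (cmod (g \<tau>))\<^sup>2) \<partial>lborel) < \<infinity>"
proof -
  \<comment> \<open>The weight supplies \<open>2 * b\<close> and the squared decay of
    \<open>g\<close> supplies -2, so \<open>e < -1\<close>. \<open>P\<close> covers the positive
    tail; its reflection will cover the negative one.\<close>
  define e where "e = 2 * b - 2"
  define P where "P = (\<lambda>x::real. ennreal (x powr e) * indicator {1..} x)"
  have P: "integral\<^sup>N lborel P < \<infinity>"
    unfolding P_def using nn_integral_powr_atLeast_1[of e] b by (simp add: e_def)
  have [measurable]: "P \<in> borel_measurable borel" unfolding P_def by measurable
  have "(\<integral>\<^sup>+\<tau>. ennreal ((1 + \<tau>\<^sup>2) powr b * (cmod (g \<tau>))\<^sup>2) \<partial>lborel)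
     \<le> (\<integral>\<^sup>+\<tau>. ennreal (2 * A\<^sup>2) * indicator {-1..1} \<tau> + ennreal (2 * B\<^sup>2) * (P \<tau> + P (- \<tau>)) \<partial>lborel)"
  proof (rule nn_integral_mono)
    fix \<tau> :: real
    have two: "2 powr b \<le> 2" using powr_mono[of b 1 2] b by simp
    show "ennreal ((1 + \<tau>\<^sup>2) powr b * (cmod (g \<tau>))\<^sup>2)
      \<le> ennreal (2 * A\<^sup>2) * indicator {-1..1} \<tau> + ennreal (2 * B\<^sup>2) * (P \<tau> + P (- \<tau>))"
    proof (cases "\<bar>\<tau>\<bar> \<le> 1")
      case True
      then have "1 + \<tau>\<^sup>2 \<le> 2" by (simp add: abs_square_le_1)
      then have "(1 + \<tau>\<^sup>2) powr b \<le> 2 powr b" using b by (intro powr_mono2) auto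
      with two have "(1 + \<tau>\<^sup>2) powr b \<le> 2" by simp
      moreover have "(cmod (g \<tau>))\<^sup>2 \<le> A\<^sup>2" using A by (intro power_mono) auto
      ultimately have "(1 + \<tau>\<^sup>2) powr b * (cmod (g \<tau>))\<^sup>2 \<le> 2 * A\<^sup>2"
        by (intro mult_mono) auto
      then show ?thesis using True
        by (intro order_trans[OF ennreal_leI add_increasing2]) (auto simp: abs_le_iff)
    next
      case False
      then have t: "\<bar>\<tau>\<bar> > 1" by simp
      then have "1 \<le> \<tau>\<^sup>2" using abs_square_le_1[of \<tau>] by linarith
      then have "(1 + \<tau>\<^sup>2) powr b \<le> (2 * \<bar>\<tau>\<bar> powr 2) powr b" using b t
        by (intro powr_mono2) (auto simp: powr_numeral)
      also have "\<dots> = 2 powr b * \<bar>\<tau>\<bar> powr (2 * b)"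
        by (subst powr_mult) (simp_all only: powr_powr abs_ge_zero zero_le_numeral powr_ge_zero)
      also have "\<dots> \<le> 2 * \<bar>\<tau>\<bar> powr (2 * b)" using two by (intro mult_right_mono) auto
      finally have 1: "(1 + \<tau>\<^sup>2) powr b \<le> 2 * \<bar>\<tau>\<bar> powr (2 * b)" .
      have "cmod (g \<tau>) \<le> B / \<bar>\<tau>\<bar>" using B[of \<tau>] t by (simp add: field_simps)
      then have "(cmod (g \<tau>))\<^sup>2 \<le> (B / \<bar>\<tau>\<bar>)\<^sup>2" by (intro power_mono) auto
      also have "\<dots> = B\<^sup>2 * \<bar>\<tau>\<bar> powr (- 2)"
        using t by (simp add: power_divide powr_minus powr_numeral field_simps)
      finally have "(1 + \<tau>\<^sup>2) powr b * (cmod (g \<tau>))\<^sup>2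
          \<le> (2 * \<bar>\<tau>\<bar> powr (2 * b)) * (B\<^sup>2 * \<bar>\<tau>\<bar> powr (- 2))"
        using 1 by (intro mult_mono) auto
      also have "\<dots> = 2 * B\<^sup>2 * \<bar>\<tau>\<bar> powr e"
        using t by (simp add: e_def powr_diff powr_minus field_simps)
      finally have "ennreal ((1 + \<tau>\<^sup>2) powr b * (cmod (g \<tau>))\<^sup>2) \<le> ennreal (2 * B\<^sup>2 * \<bar>\<tau>\<bar> powr e)"
        by (rule ennreal_leI)
      also have "\<dots> = ennreal (2 * B\<^sup>2) * ennreal (\<bar>\<tau>\<bar> powr e)" by (simp add: ennreal_mult)
      also have "ennreal (\<bar>\<tau>\<bar> powr e) \<le> P \<tau> + P (- \<tau>)"
        using t by (cases "\<tau> > 0") (auto simp: P_def)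
      finally show ?thesis by (simp add: add_increasing mult_left_mono)
    qed
  qed
  also have "\<dots> = ennreal (2 * A\<^sup>2) * 2 +
      ennreal (2 * B\<^sup>2) * (integral\<^sup>N lborel P + (\<integral>\<^sup>+\<tau>. P (- \<tau>) \<partial>lborel))"
    by (simp add: nn_integral_add nn_integral_cmult)
  also have "(\<integral>\<^sup>+\<tau>. P (- \<tau>) \<partial>lborel) = integral\<^sup>N lborel P"
    using nn_integral_real_affine[of P "-1" 0] by simp
  also have "ennreal (2 * A\<^sup>2) * 2 + ennreal (2 * B\<^sup>2) * (integral\<^sup>N lborel P + integral\<^sup>N lborel P) < \<infinity>"
    using P by (simp add: ennreal_mult_less_top ennreal_add_less_top)
  finally show ?thesis .
qed

lemma CLINT_cis_symmetric:
  assumes "S \<ge> 0"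
  shows "(CLINT t:{-S..S}|lborel. cis (- (t * \<tau>))) =
    (if \<tau> = 0 then of_real (2 * S) else of_real (2 * sin (S * \<tau>) / \<tau>))"
proof (cases "\<tau> = 0")
  case True
  then show ?thesis using assms
    by (simp add: set_integral_const[of "{-S..S}"] scaleR_conv_of_real)
next
  case False
  define F where "F = (\<lambda>t. cis (- (t * \<tau>)) / (- \<i> * of_real \<tau>))"
  have "(CLINT t:{-S..S}|lborel. cis (- (t * \<tau>))) = F S - F (- S)"
    unfolding set_lebesgue_integral_def
  proof (rule integral_FTC_Icc)
    fix x
    have "((\<lambda>z. exp (- (\<i> * of_real \<tau> * z)) / (- \<i> * of_real \<tau>)) has_field_derivative
        exp (- (\<i> * of_real \<tau> * of_real x))) (at (of_real x))"
      using False by (auto intro!: derivative_eq_intros)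
    from has_vector_derivative_real_field[OF this]
    show "(F has_vector_derivative cis (- (x * \<tau>))) (at x within {-S..S})"
      unfolding F_def cis_conv_exp by (simp add: mult_ac)
  qed (use assms in \<open>auto intro!: continuous_intros\<close>)
  also have "F S - F (- S) = of_real (2 * sin (S * \<tau>) / \<tau>)"
    using False unfolding F_def by (simp add: complex_eq_iff Re_divide Im_divide field_simps power2_eq_square)
  finally show ?thesis using False by simp
qed

text \<open>The transform is a sinc function: bounded by \<open>2 * S\<close>, and by
  \<open>2 / \<bar>\<tau>\<bar>\<close> away from 0.\<close>

lemma Hb_norm_indicator_finite:
  assumes b: "0 \<le> b" "b < 1 / 2" and S: "S \<ge> 0"
  shows "Hb_norm b (indicator {-S..S}) < \<infinity>"
proof -
  define G :: "real \<Rightarrow> complex"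
    where "G = (\<lambda>\<tau>. if \<tau> = 0 then of_real (2 * S) else of_real (2 * sin (S * \<tau>) / \<tau>))"
  have G_eq: "G \<tau> = (CLINT t:{-S..S}|lborel. cis (- (t * \<tau>)))" for \<tau>
    unfolding G_def CLINT_cis_symmetric[OF S] by simp
  have [measurable]: "G \<in> borel_measurable borel" unfolding G_def by measurable
  have bound1: "cmod (G \<tau>) \<le> 2 * S" for \<tau>
  proof -
    have "\<bar>sin (S * \<tau>)\<bar> \<le> S * \<bar>\<tau>\<bar>"
      using abs_sin_x_le_abs_x[of "S * \<tau>"] S by (simp add: abs_mult)
    then show ?thesis
      using S unfolding G_def by (auto simp: norm_mult norm_divide field_simps)
  qed
  have bound2: "cmod (G \<tau>) * \<bar>\<tau>\<bar> \<le> 2" for \<tau>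
    unfolding G_def by (auto simp: norm_mult norm_divide)
  \<comment> \<open>The exponent 0 gives square integrability of \<open>G\<close>, the exponent
    \<open>b\<close> the Sobolev norm.\<close>
  have fin: "(\<integral>\<^sup>+\<tau>. ennreal ((1 + \<tau>\<^sup>2) powr c * (cmod (G \<tau>))\<^sup>2) \<partial>lborel) < \<infinity>"
    if "0 \<le> c" "c < 1 / 2" for c
    using nn_integral_Sobolev_weight_bounded[OF that bound1 bound2] .
  \<comment> \<open>Since \<open>0 powr 0 = 0\<close>, the weight with exponent 0 simplifies to 1
    only once its base is known to be nonzero.\<close>
  have "1 + \<tau>\<^sup>2 \<noteq> 0" for \<tau> :: real by (smt (verit) zero_le_power2)
  then have "square_integrable G"
    using fin[of 0] by (simp add: square_integrable_def Lp_norm_def ennreal_root_less_top_iff[simplified])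
  moreover have "(\<integral>\<^sup>+x. ennreal ((cmod (indicator {-S..S} x))\<^sup>2) \<partial>lborel)
      = (\<integral>\<^sup>+x. indicator {-S..S} x \<partial>lborel)"
    by (intro nn_integral_cong) (auto simp: indicator_def)
  then have "square_integrable (indicator {-S..S})"
    using S by (auto simp: square_integrable_def Lp_norm_def ennreal_root_less_top_iff[simplified])
  \<comment> \<open>For \<open>R \<ge> S\<close> the truncation contains the whole support.\<close>
  moreover have "\<forall>\<^sub>F R in at_top. \<forall>\<tau>. (CLINT t:{-R..R}|lborel. indicator {-S..S} t * cis (- (t * \<tau>))) = G \<tau>"
    using eventually_ge_at_top[of S]
  proof eventually_elim
    case (elim R)
    then show ?case unfolding G_eq set_lebesgue_integral_def
      by (auto intro!: Bochner_Integration.integral_cong simp: indicator_def)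
  qed
  ultimately have "Hb_norm b (indicator {-S..S}) =
      ennreal_root 2 (\<integral>\<^sup>+\<tau>. ennreal ((1 + \<tau>\<^sup>2) powr b * (cmod (G \<tau>))\<^sup>2) \<partial>lborel)"
    by (intro Hb_norm_eq)
  then show ?thesis using fin[OF b] by (simp only: ennreal_root_less_top_iff)
qed

lemma Hb_norm_on_one_finite:
  assumes "0 \<le> b" and "b < 1 / 2" and "bounded I"
  shows "Hb_norm_on b I (\<lambda>_. 1) < \<infinity>"
proof -
  obtain S where S: "\<And>t. t \<in> I \<Longrightarrow> \<bar>t\<bar> \<le> S" and "S > 0"
    using assms(3) by (auto simp: bounded_pos)
  have "Hb_norm_on b I (\<lambda>_. 1) \<le> Hb_norm b (indicator {-S..S})"
    unfolding Hb_norm_on_def using S by (intro INF_lower) (force simp: abs_le_iff)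
  also have "\<dots> < \<infinity>" using assms \<open>S > 0\<close> by (intro Hb_norm_indicator_finite) auto
  finally show ?thesis .
qed

section \<open>Trigonometric polynomials and the dispersion relation at its inflection point\<close>

lemma fourier_coeff_trig_poly:
  assumes "finite K"
  shows "fourier_coeff (\<lambda>x. \<Sum>j\<in>K. c j * cis (of_int j * x)) k = (if k \<in> K then c k else 0)"
proof -
  have "(CLINT x:{-pi..pi}|lborel. (\<Sum>j\<in>K. c j * cis (of_int j * x)) * cis (- (of_int k * x)))
      = (CLINT x:{-pi..pi}|lborel. (\<Sum>j\<in>K. c j * cis (of_int (j - k) * x)))"
    by (simp add: sum_distrib_right mult.assoc cis_mult left_diff_distrib)
  also have "\<dots> = (\<Sum>j\<in>K. (CLINT x:{-pi..pi}|lborel. c j * cis (of_int (j - k) * x)))"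
    unfolding set_lebesgue_integral_def scaleR_sum_right
    by (rule Bochner_Integration.integral_sum)
      (rule set_integrable_cis[unfolded set_integrable_def])
  also have "\<dots> = (\<Sum>j\<in>K. (if j = k then c k * of_real (2 * pi) else 0))"
    by (intro sum.cong refl) (auto simp: integral_cis simp del: of_int_diff)
  also have "\<dots> = (if k \<in> K then c k * of_real (2 * pi) else 0)"
    using assms by simp
  finally show ?thesis unfolding fourier_coeff_def by simp
qed

text \<open>Here \<open>h * m = pi / 2\<close>, so the frequency \<open>m\<close> sits exactly at
  the inflection point. The half-angle formula turns \<open>omega0\<close> at \<open>m - j\<close>
  into \<open>2 / h^2 * (1 - sin (h * j))\<close>, and the error is the cubic Taylor remainder of
  the sine.\<close>

lemma omega0_near_inflection:
  assumes "m > 0" and h: "h = pi / real (2 * m)"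
  shows "\<bar>omega0 h (int m - int j) - (2 / h\<^sup>2 - 2 * real j / h)\<bar> \<le> h * real j ^ 3 / 3"
proof -
  have h0: "h > 0" using assms by simp
  have hm: "h * real m = pi / 2" using assms by simp
  have eq: "omega0 h (int m - int j) = 2 / h\<^sup>2 * (1 - sin (h * real j))"
  proof -
    have "cos (h * of_int (int m - int j)) = cos (pi / 2 - h * real j)"
      by (simp only: of_int_diff of_int_of_nat_eq right_diff_distrib hm)
    also have "\<dots> = sin (h * real j)" by (simp add: cos_diff)
    finally have "1 - 2 * (sin (h * of_int (int m - int j) / 2))\<^sup>2 = sin (h * real j)"
      using cos_double_sin[of "h * of_int (int m - int j) / 2"] by simp
    then have "(sin (h * of_int (int m - int j) / 2))\<^sup>2 = (1 - sin (h * real j)) / 2" by simp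
    then show ?thesis unfolding omega0_def by simp
  qed
  \<comment> \<open>The coefficient of order 2 vanishes, so three Taylor terms amount to
    \<open>h * j\<close> with a cubic remainder.\<close>
  have "\<bar>sin (h * real j) - (\<Sum>i<3. sin_coeff i * (h * real j) ^ i)\<bar>
      \<le> inverse (fact 3) * \<bar>h * real j\<bar> ^ 3"
    by (rule Maclaurin_sin_bound)
  then have sb: "\<bar>h * real j - sin (h * real j)\<bar> \<le> (h * real j) ^ 3 / 6"
    using h0 by (simp add: numeral_3_eq_3 sin_coeff_def fact_numeral abs_minus_commute)
  have "omega0 h (int m - int j) - (2 / h\<^sup>2 - 2 * real j / h)
      = 2 / h\<^sup>2 * (h * real j - sin (h * real j))"
    unfolding eq using h0 by (simp add: field_simps power2_eq_square)
  also have "\<bar>\<dots>\<bar> = 2 / h\<^sup>2 * \<bar>h * real j - sin (h * real j)\<bar>"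
    by (subst abs_mult) simp
  also have "\<dots> \<le> 2 / h\<^sup>2 * ((h * real j) ^ 3 / 6)"
    using sb by (intro mult_left_mono) auto
  also have "\<dots> = h * real j ^ 3 / 3"
    using h0 by (simp add: field_simps power2_eq_square power3_eq_cube)
  finally show ?thesis .
qed

lemma cos_ge_half:
  fixes \<theta> :: real
  assumes "\<bar>\<theta>\<bar> \<le> 1"
  shows "cos \<theta> \<ge> 1 / 2"
proof -
  have "cos (pi / 3) \<le> cos \<bar>\<theta>\<bar>"
    using assms pi_gt3 by (intro cos_monotone_0_pi_le) auto
  then show ?thesis by (simp add: cos_60)
qed

section \<open>The travelling packet and its fourth power integral\<close>

text \<open>The free evolution of a modulated Dirichlet kernel. The half-open range makes the
  frequencies \<open>m - j\<close> with \<open>j < N\<close>, so \<open>j\<close> is the distance to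
  the inflection point when \<open>h = pi / (2 * m)\<close>.\<close>

definition packet :: "real \<Rightarrow> nat \<Rightarrow> nat \<Rightarrow> real \<Rightarrow> real \<Rightarrow> complex" where
  "packet h m N t x =
     (\<Sum>k\<in>{int m - int N<..int m}. cis (- phase0 h k t) * cis (of_int k * x))"

lemma packet_alt:
  "packet h m N t x = (\<Sum>j<N. cis (real_of_int (int m - int j) * x - phase0 h (int m - int j) t))"
proof -
  have "{int m - int N<..int m} = (\<lambda>j. int m - int j) ` {..<N}"
  proof (intro equalityI subsetI)
    fix k assume "k \<in> {int m - int N<..int m}"
    then show "k \<in> (\<lambda>j. int m - int j) ` {..<N}"
      by (intro image_eqI[of _ _ "nat (int m - k)"]) auto
  qed auto
  moreover have "inj_on (\<lambda>j. int m - int j) {..<N}" by (auto intro: inj_onI)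
  ultimately show ?thesis unfolding packet_def
    by (simp add: sum.reindex cis_mult algebra_simps)
qed

lemma packet_periodic: "packet h m N t (x + 2 * pi) = packet h m N t x"
proof -
  have "cis (of_int k * (x + 2 * pi)) = cis (of_int k * x)" for k
    using cis_mult[of "of_int k * x" "2 * pi * of_int k"] cis_multiple_2pi[of "of_int k"]
    by (simp add: algebra_simps)
  then show ?thesis unfolding packet_def by simp
qed

text \<open>After a common phase is factored out, every summand has phase at most 1 in absolute
  value, hence real part at least 1/2. One half of this tolerance pays for the distance to the ray
  \<open>x = 2 * t / h\<close>, the other for the cubic remainder.\<close>

lemma packet_lower_bound:
  assumes "m > 0" and h: "h = pi / real (2 * m)"
    and x: "\<bar>x - 2 * t / h\<bar> * real N \<le> 1 / 2" and t: "\<bar>t\<bar> * h * real N ^ 3 \<le> 1 / 2"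
  shows "cmod (packet h m N t x) \<ge> real N / 2"
proof -
  have h0: "h > 0" using assms by simp
  \<comment> \<open>The phase of the summand \<open>j = 0\<close>, as
    \<open>omega0 h m = 2 / h^2\<close>.\<close>
  define \<theta> where "\<theta> = real m * x - 2 * t / h\<^sup>2"
  define \<delta> where "\<delta> = (\<lambda>j. real_of_int (int m - int j) * x - phase0 h (int m - int j) t - \<theta>)"
  have half: "cos (\<delta> j) \<ge> 1 / 2" if j: "j < N" for j
  proof (rule cos_ge_half)
    define r where "r = omega0 h (int m - int j) - (2 / h\<^sup>2 - 2 * real j / h)"
    \<comment> \<open>The part linear in \<open>j\<close> vanishes on the ray of group velocity
      \<open>2 / h\<close>.\<close>
    have "\<delta> j = - (real j * (x - 2 * t / h)) - t * r"
      unfolding \<delta>_def \<theta>_def r_def phase0_def by (simp add: algebra_simps)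
    then have "\<bar>\<delta> j\<bar> \<le> real j * \<bar>x - 2 * t / h\<bar> + \<bar>t\<bar> * \<bar>r\<bar>"
      by (metis (no_types) abs_minus_cancel abs_mult abs_of_nat abs_triangle_ineq4)
    also have "\<dots> \<le> real N * \<bar>x - 2 * t / h\<bar> + \<bar>t\<bar> * (h * real N ^ 3)"
    proof (intro add_mono mult_mono)
      have "\<bar>r\<bar> \<le> h * real j ^ 3 / 3"
        unfolding r_def using assms(1) h by (rule omega0_near_inflection)
      also have "\<dots> \<le> h * real j ^ 3" using h0 by simp
      also have "\<dots> \<le> h * real N ^ 3" using h0 j by (intro mult_left_mono power_mono) auto
      finally show "\<bar>r\<bar> \<le> h * real N ^ 3" .
    qed (use j in auto)
    also have "\<dots> \<le> 1" using x t by (simp add: mult_ac)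
    finally show "\<bar>\<delta> j\<bar> \<le> 1" .
  qed
  have "packet h m N t x = (\<Sum>j<N. cis \<theta> * cis (\<delta> j))"
    unfolding packet_alt by (intro sum.cong refl) (simp add: cis_mult \<delta>_def)
  also have "\<dots> = cis \<theta> * (\<Sum>j<N. cis (\<delta> j))" by (simp add: sum_distrib_left)
  finally have "cmod (packet h m N t x) = cmod (\<Sum>j<N. cis (\<delta> j))" by (simp add: norm_mult)
  also have "\<dots> \<ge> Re (\<Sum>j<N. cis (\<delta> j))" by (rule complex_Re_le_cmod)
  also have "Re (\<Sum>j<N. cis (\<delta> j)) = (\<Sum>j<N. cos (\<delta> j))" by simp
  also have "\<dots> \<ge> (\<Sum>j<N. 1 / 2)" using half by (intro sum_mono) auto
  finally show ?thesis by simp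
qed

text \<open>The window around \<open>s\<close> is moved by a multiple of the period until its centre
  lies in the fundamental domain. It may still stick out on one side, so only one half is kept:
  hence \<open>d\<close> and not \<open>2 * d\<close>.\<close>

lemma nn_integral_periodic_ge:
  fixes f :: "real \<Rightarrow> real"
  assumes per: "\<And>x. f (x + 2 * pi) = f x"
    and low: "\<And>x. \<bar>x - s\<bar> \<le> d \<Longrightarrow> f x \<ge> c" and d: "0 \<le> d" "d \<le> pi"
  shows "(\<integral>\<^sup>+x\<in>{-pi..pi}. ennreal (f x) \<partial>lborel) \<ge> ennreal (c * d)"
proof (cases "c \<ge> 0")
  case True
  have per_nat: "f (x + 2 * pi * real n) = f x" for x and n :: nat
  proof (induction n)
    case (Suc n)
    have "x + 2 * pi * real (Suc n) = (x + 2 * pi * real n) + 2 * pi" by (simp add: algebra_simps)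
    then show ?case using Suc per by presburger
  qed simp
  have per_int: "f (x + 2 * pi * of_int n) = f x" for x and n :: int
    using per_nat[of x "nat n"] per_nat[of "x + 2 * pi * of_int n" "nat (- n)"]
    by (cases "n \<ge> 0") auto
  define n where "n = \<lfloor>(s + pi) / (2 * pi)\<rfloor>"
  define s' where "s' = s - 2 * pi * of_int n"
  have "of_int n \<le> (s + pi) / (2 * pi)" "(s + pi) / (2 * pi) < of_int n + 1"
    unfolding n_def by linarith+
  then have s': "- pi \<le> s'" "s' \<le> pi"
    unfolding s'_def by (simp_all add: field_simps)
  \<comment> \<open>The half of the window pointing towards 0 stays inside because
    \<open>d \<le> pi\<close>.\<close>
  define a where "a = (if s' \<ge> 0 then s' - d else s')"
  have sub: "{a..a + d} \<subseteq> {-pi..pi}" using s' d by (auto simp: a_def split: if_splits)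
  have "f x \<ge> c" if "x \<in> {a..a + d}" for x
  proof -
    have "\<bar>x + 2 * pi * of_int n - s\<bar> \<le> d"
      using that d by (auto simp: a_def s'_def split: if_splits)
    from low[OF this] show ?thesis by (simp add: per_int)
  qed
  with sub have "ennreal c * indicator {a..a + d} x \<le> ennreal (f x) * indicator {-pi..pi} x" for x
    by (auto simp: indicator_def intro!: ennreal_leI)
  then have "(\<integral>\<^sup>+x. ennreal c * indicator {a..a + d} x \<partial>lborel)
      \<le> (\<integral>\<^sup>+x\<in>{-pi..pi}. ennreal (f x) \<partial>lborel)"
    by (rule nn_integral_mono)
  then show ?thesis using d True by (simp add: nn_integral_cmult ennreal_mult)
next
  case False
  then have "c * d \<le> 0" using d by (simp add: mult_le_0_iff)
  then show ?thesis by (simp add: ennreal_neg)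
qed

lemma continuous_on_packet: "continuous_on UNIV (\<lambda>(t, x). packet h m N t x)"
  unfolding packet_def phase0_def case_prod_beta by (intro continuous_intros)

text \<open>At each time in the open interval the modulus is at least \<open>N / 2\<close> on a
  window of radius \<open>1 / (2 * N)\<close>, so the integral in space is at least
  \<open>(N / 2)^4 / (2 * N) = N^3 / 32\<close>; integration in time gives the factor
  \<open>b - a\<close>.\<close>

lemma packet_Lp_norm_ge:
  assumes m: "m > 0" and h: "h = pi / real (2 * m)" and N: "N > 0"
    and ab: "a \<le> b" "{a<..<b} \<subseteq> I"
    and T: "\<And>t. t \<in> I \<Longrightarrow> \<bar>t\<bar> \<le> T" "T * h * real N ^ 3 \<le> 1 / 2"
  shows "Lp_norm 4 (I \<times> {-pi..pi}) (\<lambda>(t, x). packet h m N t x)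
    \<ge> ennreal (root 4 ((b - a) * real N ^ 3 / 32))"
proof -
  define c where "c = (real N / 2) ^ 4 * (1 / (2 * real N))"
  have c0: "c \<ge> 0" unfolding c_def by simp
  have h0: "h > 0" using m h by simp
  have slice: "(\<integral>\<^sup>+x\<in>{-pi..pi}. ennreal (cmod (packet h m N t x) ^ 4) \<partial>lborel) \<ge> ennreal c"
    if "t \<in> {a<..<b}" for t
    unfolding c_def
  proof (rule nn_integral_periodic_ge[where s = "2 * t / h"])
    fix x assume "\<bar>x - 2 * t / h\<bar> \<le> 1 / (2 * real N)"
    then have 1: "\<bar>x - 2 * t / h\<bar> * real N \<le> 1 / 2" using N by (simp add: field_simps)
    have "\<bar>t\<bar> * h * real N ^ 3 \<le> T * h * real N ^ 3"
      using T(1)[of t] ab that h0 by (intro mult_right_mono) auto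
    with T(2) have "\<bar>t\<bar> * h * real N ^ 3 \<le> 1 / 2" by simp
    from packet_lower_bound[OF m h 1 this]
    show "(real N / 2) ^ 4 \<le> cmod (packet h m N t x) ^ 4" by (intro power_mono) auto
  next
    have "1 / (2 * real N) \<le> 1" using N by simp
    then show "1 / (2 * real N) \<le> pi" using pi_gt3 by linarith
  qed (auto simp: packet_periodic)
  have [measurable]: "(\<lambda>p. packet h m N (fst p) (snd p)) \<in> borel_measurable borel"
    using borel_measurable_continuous_onI[OF continuous_on_packet] by (simp add: case_prod_beta')
  \<comment> \<open>Tonelli is applied on a Borel rectangle; the passage to \<open>I\<close> is by
    pointwise monotonicity.\<close>
  define g :: "real \<times> real \<Rightarrow> ennreal" where
    "g = (\<lambda>p. ennreal (cmod (packet h m N (fst p) (snd p)) ^ 4) * indicator ({a<..<b} \<times> {-pi..pi}) p)"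
  have [measurable]: "{a<..<b} \<times> {-pi..pi} \<in> sets borel" by (intro borel_Times) auto
  have gm: "g \<in> borel_measurable (lborel \<Otimes>\<^sub>M lborel)"
    unfolding lborel_prod g_def by measurable
  have "ennreal (c * (b - a)) = (\<integral>\<^sup>+t. ennreal c * indicator {a<..<b} t \<partial>lborel)"
    using ab c0 by (simp add: nn_integral_cmult ennreal_mult)
  also have "\<dots> \<le> (\<integral>\<^sup>+t. \<integral>\<^sup>+x. g (t, x) \<partial>lborel \<partial>lborel)"
  proof (rule nn_integral_mono)
    fix t :: real
    show "ennreal c * indicator {a<..<b} t \<le> (\<integral>\<^sup>+x. g (t, x) \<partial>lborel)"
      using slice[of t] by (cases "t \<in> {a<..<b}") (auto simp: g_def indicator_times)
  qed
  also have "\<dots> = (\<integral>\<^sup>+p. g p \<partial>lborel)"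
    using lborel.nn_integral_fst[OF gm] by (simp add: lborel_prod)
  also have "\<dots> \<le> (\<integral>\<^sup>+p\<in>I \<times> {-pi..pi}. ennreal (cmod (case p of (t, x) \<Rightarrow> packet h m N t x) ^ 4) \<partial>lborel)"
    using ab by (intro nn_integral_mono) (auto simp: g_def indicator_def)
  finally have "ennreal_root 4 (ennreal (c * (b - a)))
      \<le> Lp_norm 4 (I \<times> {-pi..pi}) (\<lambda>(t, x). packet h m N t x)"
    unfolding Lp_norm_def by (intro ennreal_root_mono) auto
  moreover have "c * (b - a) = (b - a) * real N ^ 3 / 32"
    using N by (simp add: c_def field_simps power_numeral_reduce)
  ultimately show ?thesis using ab by (simp add: ennreal_root_ennreal)
qed

section \<open>The packet under the projector and in the Bourgain norm\<close>

lemma fourier_coeff_packet: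
  "fourier_coeff (packet h m N t) k =
     (if k \<in> {int m - int N<..int m} then cis (- phase0 h k t) else 0)"
  unfolding packet_def by (rule fourier_coeff_trig_poly) simp

text \<open>The top frequency satisfies \<open>h * m = pi / 2 \<le> \<Lambda> * pi\<close>, and
  \<open>N \<le> m\<close> keeps all frequencies positive.\<close>

lemma packet_freqs_subset:
  assumes "m > 0" and "N \<le> m" and h: "h = pi / real (2 * m)" and "1 / 2 \<le> \<Lambda>"
  shows "{int m - int N<..int m} \<subseteq> E_freqs \<Lambda> h"
proof
  fix k assume k: "k \<in> {int m - int N<..int m}"
  have "h * of_int k \<le> h * real m" using k assms by (intro mult_left_mono) auto
  also have "\<dots> = 1 / 2 * pi" using assms by simp
  also have "\<dots> \<le> \<Lambda> * pi" using assms by (intro mult_right_mono) auto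
  finally have "h * of_int k \<le> \<Lambda> * pi" .
  moreover have "h * of_int k \<ge> 0" using k assms by auto
  moreover have "k \<in> mesh_freqs h"
    using k assms mesh_freqs_pi[of "2 * m"] by auto
  ultimately show "k \<in> E_freqs \<Lambda> h" unfolding E_freqs_def by auto
qed

lemma spacetime_proj_packet:
  assumes "m > 0" and "N \<le> m" and "h = pi / real (2 * m)" and "1 / 2 \<le> \<Lambda>"
  shows "spacetime_proj \<Lambda> h (packet h m N) = packet h m N"
proof (intro ext)
  fix t x
  show "spacetime_proj \<Lambda> h (packet h m N) t x = packet h m N t x"
    unfolding spacetime_proj_def proj_def fourier_coeff_packet
    unfolding packet_def
    using packet_freqs_subset[OF assms] finite_E_freqs
    by (intro sum.mono_neutral_cong_right) auto
qed

text \<open>The phase factor undoes the free evolution, so each of the \<open>N\<close> coefficients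
  becomes the constant 1.\<close>

lemma X0_norm_on_packet:
  assumes "m > 0" and "N \<le> m" and "h = pi / real (2 * m)"
  shows "X0_norm_on h b I (packet h m N) =
    ennreal_root 2 (of_nat N * (Hb_norm_on b I (\<lambda>_. 1))\<^sup>2)"
proof -
  let ?K = "{int m - int N<..int m}"
  have "?K \<subseteq> mesh_freqs h"
    using packet_freqs_subset[OF assms, of 1] by (auto simp: E_freqs_def)
  moreover have "Hb_norm_on b I (\<lambda>t. cis (phase0 h k t) * fourier_coeff (packet h m N t) k)
     = (if k \<in> ?K then Hb_norm_on b I (\<lambda>_. 1) else 0)" for k
    unfolding fourier_coeff_packet by (auto simp: cis_mult Hb_norm_on_zero)
  ultimately have "(\<Sum>k\<in>mesh_freqs h.
       (Hb_norm_on b I (\<lambda>t. cis (phase0 h k t) * fourier_coeff (packet h m N t) k))\<^sup>2)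
     = (\<Sum>k\<in>?K. (Hb_norm_on b I (\<lambda>_. 1))\<^sup>2)"
    using finite_mesh_freqs by (intro sum.mono_neutral_cong_right) auto
  then show ?thesis unfolding X0_norm_on_def by simp
qed

lemma spacetime_function_packet:
  assumes "is_interval I"
  shows "spacetime_function I (packet h m N)"
  unfolding spacetime_function_def
proof (intro conjI ballI allI AE_I2 impI)
  have [measurable]: "I \<in> sets borel" using assms by (rule real_interval_borel_measurable)
  have [measurable]: "(\<lambda>(t, x). packet h m N t x) \<in> borel_measurable borel"
    by (rule borel_measurable_continuous_onI[OF continuous_on_packet])
  have [measurable]: "I \<times> {-pi..pi} \<in> sets borel" by (intro borel_Times) auto
  show "set_borel_measurable lborel (I \<times> {-pi..pi}) (\<lambda>(t, x). packet h m N t x)"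
    unfolding set_borel_measurable_def by measurable
  fix t
  show "set_integrable lborel {-pi..pi} (packet h m N t)"
    unfolding packet_def[abs_def]
    by (intro borel_integrable_atLeastAtMost' continuous_intros)
qed (rule packet_periodic)

section \<open>The contradiction for large \<open>N\<close> and small \<open>h\<close>\<close>

theorem proposition3p2:
  fixes \<Lambda> b\<^sub>0 :: real and I :: "real set"
  assumes "1 / 2 \<le> \<Lambda>" and "\<Lambda> \<le> 1"
    and "3 / 8 < b\<^sub>0" and "b\<^sub>0 < 1 / 2"
    and "is_interval I" and "bounded I" and "interior I \<noteq> {}"
  shows "\<not> (\<exists>C::real. C > 0 \<and>
           (\<forall>\<^sub>F h in at_right 0. admissible h \<longrightarrow>
              (\<forall>U. spacetime_function I U \<longrightarrow>
                 Lp_norm 4 (I \<times> {-pi..pi}) (\<lambda>(t, x). spacetime_proj \<Lambda> h U t x)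
                   \<le> ennreal C * X0_norm_on h b\<^sub>0 I (spacetime_proj \<Lambda> h U))))"
proof (intro notI, elim exE conjE)
  fix C :: real
  assume C: "C > 0"
    and ev: "\<forall>\<^sub>F h in at_right 0. admissible h \<longrightarrow>
              (\<forall>U. spacetime_function I U \<longrightarrow>
                 Lp_norm 4 (I \<times> {-pi..pi}) (\<lambda>(t, x). spacetime_proj \<Lambda> h U t x)
                   \<le> ennreal C * X0_norm_on h b\<^sub>0 I (spacetime_proj \<Lambda> h U))"
  obtain T where T: "\<And>t. t \<in> I \<Longrightarrow> \<bar>t\<bar> \<le> T"
    using assms(6) by (auto simp: bounded_iff)
  obtain z e where e: "e > 0" "ball z e \<subseteq> I"
    using assms(7) by (auto simp: mem_interior)
  define A where "A = enn2real (Hb_norm_on b\<^sub>0 I (\<lambda>_. 1))"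
  have A: "Hb_norm_on b\<^sub>0 I (\<lambda>_. 1) = ennreal A" "A \<ge> 0"
    unfolding A_def using Hb_norm_on_one_finite[of b\<^sub>0 I] assms by auto
  \<comment> \<open>Chosen to violate the inequality \<open>e * N / 16 \<le> (C * A)^4\<close>
    reached at the end.\<close>
  obtain N :: nat where N: "real N > 16 * (C * A) ^ 4 / e"
    using reals_Archimedean2 by blast
  moreover have "16 * (C * A) ^ 4 / e \<ge> 0" using e by simp
  ultimately have N0: "N > 0" by (metis of_nat_0_less_iff order_le_less_trans)
  \<comment> \<open>Mesh sizes \<open>pi / M\<close> with even \<open>M = 2 * m\<close> put a
    frequency at the inflection point, and they suffice to exploit \<open>ev\<close>.\<close>
  have lim: "filterlim (\<lambda>m::nat. pi / real (2 * m)) (at_right 0) sequentially"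
    by real_asymp
  \<comment> \<open>\<open>N\<close> stays fixed while the mesh is refined, so the cubic phase error
    vanishes in the limit.\<close>
  have "((\<lambda>m::nat. T * (pi / real (2 * m)) * real N ^ 3) \<longlongrightarrow> 0) sequentially"
    by real_asymp
  then have "\<forall>\<^sub>F m::nat in sequentially. T * (pi / real (2 * m)) * real N ^ 3 < 1 / 2"
    by (rule order_tendstoD) simp
  moreover have "\<forall>\<^sub>F m::nat in sequentially. m \<ge> N \<and> m > 0"
    by (intro eventually_conj eventually_ge_at_top eventually_gt_at_top)
  moreover note eventually_compose_filterlim[OF ev lim]
  ultimately have "\<forall>\<^sub>F m::nat in sequentially. False"
  proof eventually_elim
    case (elim m)
    define h where "h = pi / real (2 * m)"
    have m: "m > 0" "N \<le> m" using elim by auto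
    have "admissible h" unfolding admissible_def h_def using m by (intro exI[of _ "2 * m"]) simp
    with elim(3) spacetime_function_packet[OF assms(5)]
    have "Lp_norm 4 (I \<times> {-pi..pi}) (\<lambda>(t, x). spacetime_proj \<Lambda> h (packet h m N) t x)
        \<le> ennreal C * X0_norm_on h b\<^sub>0 I (spacetime_proj \<Lambda> h (packet h m N))"
      unfolding h_def by blast
    then have le: "Lp_norm 4 (I \<times> {-pi..pi}) (\<lambda>(t, x). packet h m N t x)
        \<le> ennreal C * X0_norm_on h b\<^sub>0 I (packet h m N)"
      using spacetime_proj_packet[OF m h_def assms(1)] by simp
    \<comment> \<open>The ball is an open interval of length \<open>2 * e\<close>, which turns the
      32 into 16 below.\<close>
    have "ennreal (root 4 (((z + e) - (z - e)) * real N ^ 3 / 32))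
        \<le> Lp_norm 4 (I \<times> {-pi..pi}) (\<lambda>(t, x). packet h m N t x)"
      using m N0 e T elim(1)
      by (intro packet_Lp_norm_ge[where T = T]) (auto simp: h_def ball_eq_greaterThanLessThan)
    also note le
    also have "X0_norm_on h b\<^sub>0 I (packet h m N) = ennreal (sqrt (real N * A\<^sup>2))"
      unfolding X0_norm_on_packet[OF m h_def] A sqrt_def
      by (subst ennreal_root_ennreal[symmetric])
        (use A in \<open>auto simp: ennreal_mult ennreal_power ennreal_of_nat_eq_real_of_nat\<close>)
    also have "ennreal C * \<dots> = ennreal (C * sqrt (real N * A\<^sup>2))"
      using C by (simp add: ennreal_mult)
    finally have "root 4 (e * real N ^ 3 / 16) \<le> C * sqrt (real N * A\<^sup>2)"
      using C by (subst (asm) ennreal_le_iff) auto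
    \<comment> \<open>Fourth powers compare \<open>N^3\<close> on the left with \<open>N^2\<close>
      on the right.\<close>
    then have "root 4 (e * real N ^ 3 / 16) ^ 4 \<le> (C * sqrt (real N * A\<^sup>2)) ^ 4"
      using e by (intro power_mono) auto
    also have "root 4 (e * real N ^ 3 / 16) ^ 4 = e * real N ^ 3 / 16"
      using e by (intro real_root_pow_pos2) auto
    also have "(C * sqrt (real N * A\<^sup>2)) ^ 4 = (C * A) ^ 4 * real N ^ 2"
    proof -
      have "sqrt (real N * A\<^sup>2) ^ 4 = (sqrt (real N * A\<^sup>2) ^ 2) ^ 2"
        by (simp only: power_mult[symmetric]) simp
      also have "\<dots> = (real N * A\<^sup>2)\<^sup>2" by simp
      finally show ?thesis by (simp add: power_mult_distrib power_mult[symmetric])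
    qed
    finally have "(e * real N / 16) * real N ^ 2 \<le> (C * A) ^ 4 * real N ^ 2"
      by (simp add: power_numeral_reduce mult_ac)
    then have "e * real N / 16 \<le> (C * A) ^ 4" using N0 by simp
    with N e show False by (simp add: field_simps)
  qed
  then show False by simp
qed

end
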